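(* Let $f\in\mathcal{D}'(\mathbb{R})$, $x_0\in\mathbb{R}$, and let $\gamma$ be a constant. Then the following are equivalent: 1. For every standard delta sequence $\{\phi_n\}_{n=1}^\infty$ generated by a positive normalized even test function of $\mathcal{D}(\mathbb{R})$, $$\lim_{n\to\infty}\langle f(x_0+x),\phi_n(x)\rangle=\gamma .$$ 2. The symmetric distributional point value of $f$ exists at $x_0$ and equals $\gamma$.
   Context: $\mathcal{D}(\mathbb{R})$ is the space of compactly supported $C^\infty$ functions, $\mathcal{D}'(\mathbb{R})$ its dual (distributions). A test function $\phi$ is positive if $\phi\ge0$ everywhere and normalized if $\int_{-\infty}^{\infty}\phi=1$. The standard delta sequence generated by a normalized $\phi\in\mathcal{D}(\mathbb{R})$ is $\phi_n(x)=n\phi(nx)$, $n=1,2,\dots$. Translations and dilations of distributions are defined by change of variables: $\langle f(x_0+\varepsilon x),\phi(x)\rangle=|\varepsilon|^{-1}\langle f(y),\phi((y-x_0)/\varepsilon)\rangle$ for $\varepsilon\ne0$. The symmetric distributional point value of $f$ exists at $x_0$ and equals $\gamma$ if $$\lim_{\varepsilon\to0}\frac{f(x_0+\varepsilon x)+f(x_0-\varepsilon x)}{2}=\gamma$$ in $\mathcal{D}'(\mathbb{R})$, that is, if $\lim_{\varepsilon\to0}\left\langle\tfrac12\left(f(x_0+\varepsilon x)+f(x_0-\varepsilon x)\right),\phi(x)\right\rangle=\gamma\int_{-\infty}^\infty\phi(x)\,\mathrm{d}x$ for all $\phi\in\mathcal{D}(\mathbb{R})$. *)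

theory Defs
  imports "HOL-Analysis.Analysis"
begin

section \<open>Test functions\<close>

definition nth_deriv :: "nat \<Rightarrow> (real \<Rightarrow> complex) \<Rightarrow> real \<Rightarrow> complex" where
  "nth_deriv k \<phi> = ((\<lambda>g x. vector_derivative g (at x)) ^^ k) \<phi>"

definition test_functions :: "(real \<Rightarrow> complex) set" where
  "test_functions =
     {\<phi>. (\<forall>k x. nth_deriv k \<phi> differentiable (at x)) \<and> compact (closure {x. \<phi> x \<noteq> 0})}"

definition test_functions_on :: "real set \<Rightarrow> (real \<Rightarrow> complex) set" where
  "test_functions_on K = {\<phi> \<in> test_functions. closure {x. \<phi> x \<noteq> 0} \<subseteq> K}"

text \<open>
  The usual locally convex inductive limit topology of the spaces of test functions supported in
  a fixed compact set, the latter carrying uniform convergence of each derivative: an absolutely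
  convex set of test functions is a basic neighbourhood of zero iff for every compact \<open>K\<close> its
  trace on \<^term>\<open>test_functions_on K\<close> contains a ball of one of the norms
  \<open>max\<^sub>k\<^sub>\<le>\<^sub>N sup\<^sub>x \<bar>\<phi>\<^sup>(\<^sup>k\<^sup>) x\<bar>\<close>.
\<close>

definition absolutely_convex :: "(real \<Rightarrow> complex) set \<Rightarrow> bool" where
  "absolutely_convex W \<longleftrightarrow>
     (\<forall>\<phi>\<in>W. \<forall>\<psi>\<in>W. \<forall>a b. cmod a + cmod b \<le> 1 \<longrightarrow> (\<lambda>x. a * \<phi> x + b * \<psi> x) \<in> W)"

definition zero_nhds :: "(real \<Rightarrow> complex) set set" where
  "zero_nhds = {W. W \<subseteq> test_functions \<and> absolutely_convex W \<and>
     (\<forall>K. compact K \<longrightarrow> (\<exists>N. \<exists>\<delta>>0.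
        {\<phi> \<in> test_functions_on K. \<forall>k\<le>N. \<forall>x. cmod (nth_deriv k \<phi> x) \<le> \<delta>} \<subseteq> W))}"

definition test_open :: "(real \<Rightarrow> complex) set \<Rightarrow> bool" where
  "test_open U \<longleftrightarrow> U \<subseteq> test_functions \<and>
     (\<forall>\<phi>\<in>U. \<exists>W\<in>zero_nhds. (\<lambda>\<psi> x. \<phi> x + \<psi> x) ` W \<subseteq> U)"

definition test_topology :: "(real \<Rightarrow> complex) topology" where
  "test_topology = topology test_open"

lemma zero_nhds_Int:
  assumes "V \<in> zero_nhds" "W \<in> zero_nhds"
  shows "V \<inter> W \<in> zero_nhds"
proof -
  have "\<exists>N. \<exists>\<delta>>0. {\<phi> \<in> test_functions_on K. \<forall>k\<le>N. \<forall>x. cmod (nth_deriv k \<phi> x) \<le> \<delta>} \<subseteq> V \<inter> W"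
    if K: "compact K" for K
  proof -
    obtain M \<delta> where 1: "\<delta> > 0"
      "{\<phi> \<in> test_functions_on K. \<forall>k\<le>M. \<forall>x. cmod (nth_deriv k \<phi> x) \<le> \<delta>} \<subseteq> V"
      using assms(1) K unfolding zero_nhds_def by blast
    obtain N \<epsilon> where 2: "\<epsilon> > 0"
      "{\<phi> \<in> test_functions_on K. \<forall>k\<le>N. \<forall>x. cmod (nth_deriv k \<phi> x) \<le> \<epsilon>} \<subseteq> W"
      using assms(2) K unfolding zero_nhds_def by blast
    have "{\<phi> \<in> test_functions_on K. \<forall>k\<le>max M N. \<forall>x. cmod (nth_deriv k \<phi> x) \<le> min \<delta> \<epsilon>}
            \<subseteq> V \<inter> W"
      using 1(2) 2(2) by (auto simp: le_max_iff_disj)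
    moreover have "min \<delta> \<epsilon> > 0" using 1 2 by simp
    ultimately show ?thesis by blast
  qed
  moreover have "V \<inter> W \<subseteq> test_functions" "absolutely_convex (V \<inter> W)"
    using assms unfolding zero_nhds_def absolutely_convex_def by auto
  ultimately show ?thesis unfolding zero_nhds_def by blast
qed

lemma istopology_test_open: "istopology test_open"
  unfolding istopology_def
proof (intro conjI allI impI)
  fix S T assume S: "test_open S" and T: "test_open T"
  show "test_open (S \<inter> T)"
    unfolding test_open_def
  proof (intro conjI ballI)
    show "S \<inter> T \<subseteq> test_functions" using S unfolding test_open_def by auto
    fix \<phi> assume "\<phi> \<in> S \<inter> T"
    then obtain V W where "V \<in> zero_nhds" "(\<lambda>\<psi> x. \<phi> x + \<psi> x) ` V \<subseteq> S"
      "W \<in> zero_nhds" "(\<lambda>\<psi> x. \<phi> x + \<psi> x) ` W \<subseteq> T"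
      using S T unfolding test_open_def by (meson IntD1 IntD2)
    then show "\<exists>W\<in>zero_nhds. (\<lambda>\<psi> x. \<phi> x + \<psi> x) ` W \<subseteq> S \<inter> T"
      by (intro bexI[of _ "V \<inter> W"] zero_nhds_Int) auto
  qed
next
  fix \<K> assume *: "\<forall>K\<in>\<K>. test_open K"
  show "test_open (\<Union>\<K>)"
    unfolding test_open_def
  proof (intro conjI ballI)
    show "\<Union>\<K> \<subseteq> test_functions" using * unfolding test_open_def by blast
    fix \<phi> assume "\<phi> \<in> \<Union>\<K>"
    then obtain K where K: "K \<in> \<K>" "\<phi> \<in> K" by blast
    then obtain W where "W \<in> zero_nhds" "(\<lambda>\<psi> x. \<phi> x + \<psi> x) ` W \<subseteq> K"
      using * unfolding test_open_def by metis
    then show "\<exists>W\<in>zero_nhds. (\<lambda>\<psi> x. \<phi> x + \<psi> x) ` W \<subseteq> \<Union>\<K>" using K by blast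
  qed
qed

lemma openin_test_topology: "openin test_topology = test_open"
  unfolding test_topology_def by (rule topology_inverse'[OF istopology_test_open])

lemma nth_deriv_lincomb:
  assumes "\<phi> \<in> test_functions" "\<psi> \<in> test_functions"
  shows "nth_deriv k (\<lambda>x. a * \<phi> x + b * \<psi> x) = (\<lambda>x. a * nth_deriv k \<phi> x + b * nth_deriv k \<psi> x)"
proof (induction k)
  case 0
  then show ?case by (simp add: nth_deriv_def)
next
  case (Suc k)
  have d: "(nth_deriv k g has_vector_derivative nth_deriv (Suc k) g x) (at x)"
    if "g \<in> test_functions" for g x
    using that unfolding test_functions_def nth_deriv_def
    by (simp add: vector_derivative_works)
  have "nth_deriv (Suc k) (\<lambda>x. a * \<phi> x + b * \<psi> x)
      = (\<lambda>x. vector_derivative (nth_deriv k (\<lambda>x. a * \<phi> x + b * \<psi> x)) (at x))"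
    by (simp add: nth_deriv_def)
  also have "\<dots> = (\<lambda>x. a * nth_deriv (Suc k) \<phi> x + b * nth_deriv (Suc k) \<psi> x)"
    unfolding Suc.IH
    by (intro ext vector_derivative_at has_vector_derivative_add
        has_vector_derivative_mult_right d assms)
  finally show ?case .
qed

lemma test_functions_lincomb:
  assumes "\<phi> \<in> test_functions" "\<psi> \<in> test_functions"
  shows "(\<lambda>x. a * \<phi> x + b * \<psi> x) \<in> test_functions"
proof -
  let ?P = "closure {x. \<phi> x \<noteq> 0}" and ?Q = "closure {x. \<psi> x \<noteq> 0}"
  let ?R = "closure {x. a * \<phi> x + b * \<psi> x \<noteq> 0}"
  have sub: "?R \<subseteq> ?P \<union> ?Q"
    unfolding closure_Un[symmetric] by (rule closure_mono) auto
  have "compact (?P \<union> ?Q)"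
    using assms unfolding test_functions_def by (intro compact_Un) auto
  then have "compact ((?P \<union> ?Q) \<inter> ?R)"
    by (rule compact_Int_closed) (rule closed_closure)
  then have "compact ?R" by (subst (asm) Int_absorb1[OF sub])
  moreover have "nth_deriv k (\<lambda>x. a * \<phi> x + b * \<psi> x) differentiable (at x)" for k x
    unfolding nth_deriv_lincomb[OF assms] using assms unfolding test_functions_def
    by (intro differentiable_add differentiable_mult differentiable_const) auto
  ultimately show ?thesis unfolding test_functions_def by simp
qed

lemma topspace_test_topology: "topspace test_topology = test_functions"
proof -
  have "test_functions \<in> zero_nhds"
    unfolding zero_nhds_def absolutely_convex_def test_functions_on_def
    by (auto intro: test_functions_lincomb gt_ex)
  then have "test_open test_functions"
    unfolding test_open_def using test_functions_lincomb[where a = 1 and b = 1]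
    by (intro conjI ballI bexI[of _ test_functions]) auto
  then show ?thesis
    using openin_subset[of test_topology test_functions] openin_topspace[of test_topology]
    unfolding openin_test_topology test_open_def by (intro subset_antisym) auto
qed

section \<open>Distributions\<close>

text \<open>
  A distribution is represented by a total function of which only the values on
  \<^term>\<open>test_functions\<close> matter; the pairing of \<open>f\<close> with \<open>\<phi>\<close> is \<open>f \<phi>\<close>.
\<close>

definition distributions :: "((real \<Rightarrow> complex) \<Rightarrow> complex) set" where
  "distributions = {f.
     (\<forall>\<phi>\<in>test_functions. \<forall>\<psi>\<in>test_functions. \<forall>a b.
        f (\<lambda>x. a * \<phi> x + b * \<psi> x) = a * f \<phi> + b * f \<psi>) \<and>
     continuous_map test_topology euclidean f}"

lemma distributions_iff_seminorm_estimate: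
  "f \<in> distributions \<longleftrightarrow>
     (\<forall>\<phi>\<in>test_functions. \<forall>\<psi>\<in>test_functions. \<forall>a b.
        f (\<lambda>x. a * \<phi> x + b * \<psi> x) = a * f \<phi> + b * f \<psi>) \<and>
     (\<forall>K. compact K \<longrightarrow> (\<exists>N C. \<forall>\<phi>\<in>test_functions_on K. \<forall>B>0.
        (\<forall>k\<le>N. \<forall>x. cmod (nth_deriv k \<phi> x) \<le> B) \<longrightarrow> cmod (f \<phi>) \<le> C * B))"
proof (cases "\<forall>\<phi>\<in>test_functions. \<forall>\<psi>\<in>test_functions. \<forall>a b.
        f (\<lambda>x. a * \<phi> x + b * \<psi> x) = a * f \<phi> + b * f \<psi>")
  case lin: True
  have "continuous_map test_topology euclidean f \<longleftrightarrow>
     (\<forall>K. compact K \<longrightarrow> (\<exists>N C. \<forall>\<phi>\<in>test_functions_on K. \<forall>B>0.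
        (\<forall>k\<le>N. \<forall>x. cmod (nth_deriv k \<phi> x) \<le> B) \<longrightarrow> cmod (f \<phi>) \<le> C * B))" (is "?L \<longleftrightarrow> ?R")
  proof
    assume L: ?L
    have nd0: "nth_deriv k (\<lambda>x. 0) = (\<lambda>x. 0)" for k
      by (induction k) (auto simp: nth_deriv_def)
    then have z: "(\<lambda>x. 0) \<in> test_functions"
      unfolding test_functions_def by simp
    have f0: "f (\<lambda>x. 0) = 0"
      using lin[rule_format, OF z z, of 0 0] by simp
    have "openin test_topology {\<phi> \<in> topspace test_topology. f \<phi> \<in> ball 0 1}"
      using L by (rule openin_continuous_map_preimage) auto
    then obtain W where W: "W \<in> zero_nhds" "\<And>\<psi>. \<psi> \<in> W \<Longrightarrow> cmod (f \<psi>) < 1"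
      using z f0 unfolding openin_test_topology topspace_test_topology test_open_def by fastforce
    show ?R
    proof (intro allI impI)
      fix K :: "real set" assume "compact K"
      then obtain N \<delta> where d: "\<delta> > 0"
        "{\<phi> \<in> test_functions_on K. \<forall>k\<le>N. \<forall>x. cmod (nth_deriv k \<phi> x) \<le> \<delta>} \<subseteq> W"
        using W(1) unfolding zero_nhds_def by blast
      have "cmod (f \<phi>) \<le> (1 / \<delta>) * B"
        if p: "\<phi> \<in> test_functions_on K" and B: "B > 0"
          and le: "\<forall>k\<le>N. \<forall>x. cmod (nth_deriv k \<phi> x) \<le> B" for \<phi> B
      proof -
        have p': "\<phi> \<in> test_functions" using p unfolding test_functions_on_def by auto
        define c where "c = complex_of_real (\<delta> / B)"
        define \<psi> where "\<psi> = (\<lambda>x. c * \<phi> x + 0 * \<phi> x)"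
        have cn: "cmod c = \<delta> / B" using d B unfolding c_def norm_of_real by simp
        have "c \<noteq> 0" using cn d B by auto
        then have "\<psi> \<in> test_functions_on K"
          using p test_functions_lincomb[OF p' p', of c 0]
          unfolding test_functions_on_def \<psi>_def by simp
        moreover have "cmod (nth_deriv k \<psi> x) \<le> \<delta>" if "k \<le> N" for k x
        proof -
          have "cmod (nth_deriv k \<psi> x) = \<delta> / B * cmod (nth_deriv k \<phi> x)"
            unfolding \<psi>_def nth_deriv_lincomb[OF p' p'] by (simp add: norm_mult cn)
          also have "\<dots> \<le> \<delta> / B * B"
            using le that d B by (intro mult_left_mono) auto
          finally show ?thesis using B by simp
        qed
        ultimately have "cmod (f \<psi>) < 1" using d(2) W(2) by blast
        moreover have "f \<psi> = c * f \<phi>"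
          using lin[rule_format, OF p' p', of c 0] unfolding \<psi>_def by simp
        ultimately have "\<delta> / B * cmod (f \<phi>) < 1" by (simp add: norm_mult cn)
        then show ?thesis using d B by (simp add: field_simps)
      qed
      then show "\<exists>N C. \<forall>\<phi>\<in>test_functions_on K. \<forall>B>0.
        (\<forall>k\<le>N. \<forall>x. cmod (nth_deriv k \<phi> x) \<le> B) \<longrightarrow> cmod (f \<phi>) \<le> C * B" by blast
    qed
  next
    assume R: ?R
    have W: "{\<psi> \<in> test_functions. cmod (f \<psi>) < e} \<in> zero_nhds" if e: "e > 0" for e
    proof -
      have "\<exists>N. \<exists>\<delta>>0. {\<phi> \<in> test_functions_on K. \<forall>k\<le>N. \<forall>x. cmod (nth_deriv k \<phi> x) \<le> \<delta>}
          \<subseteq> {\<psi> \<in> test_functions. cmod (f \<psi>) < e}" if K: "compact K" for K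
      proof -
        obtain N C where C: "\<forall>\<phi>\<in>test_functions_on K. \<forall>B>0.
          (\<forall>k\<le>N. \<forall>x. cmod (nth_deriv k \<phi> x) \<le> B) \<longrightarrow> cmod (f \<phi>) \<le> C * B"
          using R K by blast
        define \<delta> where "\<delta> = e / (\<bar>C\<bar> + 1)"
        have d: "\<delta> > 0" using e by (simp add: \<delta>_def)
        have "C * \<delta> < e"
        proof -
          have "C * \<delta> < (\<bar>C\<bar> + 1) * \<delta>" using d by (intro mult_strict_right_mono) auto
          also have "\<dots> = e" by (simp add: \<delta>_def)
          finally show ?thesis .
        qed
        then have "{\<phi> \<in> test_functions_on K. \<forall>k\<le>N. \<forall>x. cmod (nth_deriv k \<phi> x) \<le> \<delta>}
          \<subseteq> {\<psi> \<in> test_functions. cmod (f \<psi>) < e}"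
          using C d by (force simp: test_functions_on_def)
        then show ?thesis using d by blast
      qed
      moreover have "absolutely_convex {\<psi> \<in> test_functions. cmod (f \<psi>) < e}"
        unfolding absolutely_convex_def
      proof (intro ballI allI impI)
        fix \<phi> \<psi> and a b :: complex
        assume p: "\<phi> \<in> {\<psi> \<in> test_functions. cmod (f \<psi>) < e}"
          and q: "\<psi> \<in> {\<psi> \<in> test_functions. cmod (f \<psi>) < e}"
          and ab: "cmod a + cmod b \<le> 1"
        define m where "m = max (cmod (f \<phi>)) (cmod (f \<psi>))"
        have m: "m < e" "0 \<le> m" using p q by (auto simp: m_def le_max_iff_disj)
        have "f (\<lambda>x. a * \<phi> x + b * \<psi> x) = a * f \<phi> + b * f \<psi>" using lin p q by blast
        then have "cmod (f (\<lambda>x. a * \<phi> x + b * \<psi> x)) \<le> cmod a * cmod (f \<phi>) + cmod b * cmod (f \<psi>)"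
          using norm_triangle_ineq[of "a * f \<phi>" "b * f \<psi>"] by (simp add: norm_mult)
        also have "\<dots> \<le> cmod a * m + cmod b * m"
          by (intro add_mono mult_left_mono) (auto simp: m_def)
        also have "\<dots> = (cmod a + cmod b) * m" by (simp add: algebra_simps)
        also have "\<dots> \<le> 1 * m" using ab m by (intro mult_right_mono)
        also have "\<dots> < e" using m by simp
        finally show "(\<lambda>x. a * \<phi> x + b * \<psi> x) \<in> {\<psi> \<in> test_functions. cmod (f \<psi>) < e}"
          using p q test_functions_lincomb by auto
      qed
      ultimately show ?thesis unfolding zero_nhds_def by auto
    qed
    show ?L
      unfolding continuous_map_def openin_test_topology topspace_test_topology
    proof (intro conjI allI impI)
      show "f \<in> test_functions \<rightarrow> topspace euclidean" by simp
      fix U :: "complex set" assume "openin euclidean U"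
      then have U: "open U" by simp
      show "test_open {\<phi> \<in> test_functions. f \<phi> \<in> U}"
        unfolding test_open_def
      proof (intro conjI ballI)
        fix \<phi> assume p: "\<phi> \<in> {\<phi> \<in> test_functions. f \<phi> \<in> U}"
        then obtain e where e: "e > 0" "ball (f \<phi>) e \<subseteq> U"
          using U by (metis (no_types, lifting) mem_Collect_eq open_contains_ball)
        have "(\<lambda>x. \<phi> x + \<psi> x) \<in> {\<phi> \<in> test_functions. f \<phi> \<in> U}"
          if "\<psi> \<in> {\<psi> \<in> test_functions. cmod (f \<psi>) < e}" for \<psi>
        proof -
          have "f (\<lambda>x. \<phi> x + \<psi> x) = f \<phi> + f \<psi>" "(\<lambda>x. \<phi> x + \<psi> x) \<in> test_functions"
            using lin[rule_format, of \<phi> \<psi> 1 1] test_functions_lincomb[of \<phi> \<psi> 1 1] p that by auto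
          moreover have "f \<phi> + f \<psi> \<in> ball (f \<phi>) e"
            using that by (simp add: dist_norm)
          ultimately show ?thesis using e(2) by auto
        qed
        then show "\<exists>W\<in>zero_nhds. (\<lambda>\<psi> x. \<phi> x + \<psi> x) ` W \<subseteq> {\<phi> \<in> test_functions. f \<phi> \<in> U}"
          using W[OF e(1)] by blast
      qed auto
    qed
  qed
  then show ?thesis using lin unfolding distributions_def by blast
next
  case False
  then show ?thesis unfolding distributions_def by blast
qed

text \<open>The distribution \<open>f (x\<^sub>0 + \<epsilon> x)\<close>, for \<open>\<epsilon> \<noteq> 0\<close>.\<close>

definition affine_change ::
  "((real \<Rightarrow> complex) \<Rightarrow> complex) \<Rightarrow> real \<Rightarrow> real \<Rightarrow> (real \<Rightarrow> complex) \<Rightarrow> complex" where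
  "affine_change f x0 \<epsilon> \<phi> = f (\<lambda>y. \<phi> ((y - x0) / \<epsilon>)) / complex_of_real \<bar>\<epsilon>\<bar>"

definition has_symmetric_point_value ::
  "((real \<Rightarrow> complex) \<Rightarrow> complex) \<Rightarrow> real \<Rightarrow> complex \<Rightarrow> bool" where
  "has_symmetric_point_value f x0 \<gamma> \<longleftrightarrow>
     (\<forall>\<phi>\<in>test_functions.
        ((\<lambda>\<epsilon>. (affine_change f x0 \<epsilon> \<phi> + affine_change f x0 (- \<epsilon>) \<phi>) / 2)
          \<longlongrightarrow> \<gamma> * (LINT x|lborel. \<phi> x)) (at 0))"

section \<open>Standard delta sequences\<close>

definition positive_fun :: "(real \<Rightarrow> complex) \<Rightarrow> bool" where
  "positive_fun \<phi> \<longleftrightarrow> (\<forall>x. \<phi> x \<in> \<real>\<^sub>\<ge>\<^sub>0)"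

definition normalized_fun :: "(real \<Rightarrow> complex) \<Rightarrow> bool" where
  "normalized_fun \<phi> \<longleftrightarrow> (LINT x|lborel. \<phi> x) = 1"

definition even_fun :: "(real \<Rightarrow> complex) \<Rightarrow> bool" where
  "even_fun \<phi> \<longleftrightarrow> (\<forall>x. \<phi> (- x) = \<phi> x)"

definition delta_seq :: "(real \<Rightarrow> complex) \<Rightarrow> nat \<Rightarrow> real \<Rightarrow> complex" where
  "delta_seq \<phi> n x = of_nat n * \<phi> (real n * x)"

end

theory Submission
  imports Defs
begin

text \<open>
  Since only the even part of a test function \<open>\<phi>\<close> enters the symmetric mean, let \<open>\<phi>\<close> be even and put
  \<open>h t = \<langle>f (x\<^sub>0 + x / t), \<phi> x\<rangle>\<close> for \<open>t > 0\<close>; then (2) is the limit of \<open>h\<close> along all reals and (1),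
  extended from positive normalized to all even \<open>\<phi>\<close> by adding a large multiple of a bump function,
  the limit of \<open>h\<close> along the integers. As (1) also covers the dilations \<open>x \<mapsto> \<phi> (c x)\<close>,
  it yields the limit of \<open>h (n c)\<close> for every \<open>c > 0\<close>. The function \<open>h\<close> is continuous, so Croft's
  lemma (an application of Baire's theorem) turns this into the limit of \<open>h t\<close> as \<open>t \<rightarrow> \<infinity>\<close>.
\<close>

section \<open>Smooth functions\<close>

lemma test_functions_iff:
  "\<phi> \<in> test_functions \<longleftrightarrow>
     (\<forall>k x. nth_deriv k \<phi> differentiable (at x)) \<and> bounded {x. \<phi> x \<noteq> 0}"
  by (simp add: test_functions_def)

lemma nth_deriv_0 [simp]: "nth_deriv 0 \<phi> = \<phi>"
  by (simp add: nth_deriv_def)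

lemma nth_deriv_Suc: "nth_deriv (Suc k) \<phi> = (\<lambda>x. vector_derivative (nth_deriv k \<phi>) (at x))"
  by (simp add: nth_deriv_def)

text \<open>The definition peels off the outermost derivative; the innermost one is needed to match
  the recursion of \<open>times_differentiable\<close>.\<close>

lemma nth_deriv_Suc2: "nth_deriv (Suc k) \<phi> = nth_deriv k (\<lambda>x. vector_derivative \<phi> (at x))"
  by (simp add: nth_deriv_def funpow_swap1 del: funpow.simps flip: funpow_Suc_right)
     (simp add: funpow_Suc_right del: funpow.simps)

text \<open>Lets all derivatives be guessed as one family and checked one order at a time.\<close>

lemma nth_deriv_eqI:
  assumes "F 0 = \<phi>" "\<And>k x. (F k has_vector_derivative F (Suc k) x) (at x)"
  shows "nth_deriv k \<phi> = F k"
proof (induction k)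
  case (Suc k)
  show ?case
    unfolding nth_deriv_Suc Suc using assms(2) by (auto simp: vector_derivative_at)
qed (use assms in simp)

lemma test_functions_has_vector_derivative:
  assumes "\<phi> \<in> test_functions"
  shows "(nth_deriv k \<phi> has_vector_derivative nth_deriv (Suc k) \<phi> x) (at x)"
  using assms by (simp add: test_functions_iff nth_deriv_Suc vector_derivative_works)

lemma continuous_on_nth_deriv:
  assumes "\<phi> \<in> test_functions"
  shows "continuous_on S (nth_deriv k \<phi>)"
  using test_functions_has_vector_derivative[OF assms]
  by (meson continuous_at_imp_continuous_on has_vector_derivative_continuous)

lemma test_functionsI:
  assumes "F 0 = \<phi>" "\<And>k x. (F k has_vector_derivative F (Suc k) x) (at x)"
    and "bounded {x. \<phi> x \<noteq> 0}"
  shows "\<phi> \<in> test_functions"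
  unfolding test_functions_iff nth_deriv_eqI[OF assms(1,2)]
  using assms(2,3) differentiableI_vector by blast

lemma
  assumes "\<phi> \<in> test_functions" "a \<noteq> 0"
  shows nth_deriv_affine:
      "nth_deriv k (\<lambda>x. \<phi> (a * x + b)) = (\<lambda>x. of_real (a ^ k) * nth_deriv k \<phi> (a * x + b))"
    and test_functions_affine: "(\<lambda>x. \<phi> (a * x + b)) \<in> test_functions"
proof -
  define F where "F k = (\<lambda>x. complex_of_real (a ^ k) * nth_deriv k \<phi> (a * x + b))" for k
  have F0: "F 0 = (\<lambda>x. \<phi> (a * x + b))"
    by (simp add: F_def)
  have FS: "(F k has_vector_derivative F (Suc k) x) (at x)" for k x
  proof -
    have "((\<lambda>x. a * x + b) has_vector_derivative a) (at x)"
      by (auto intro!: derivative_eq_intros simp flip: has_real_derivative_iff_has_vector_derivative)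
    then have "((nth_deriv k \<phi> \<circ> (\<lambda>x. a * x + b)) has_vector_derivative
        a *\<^sub>R nth_deriv (Suc k) \<phi> (a * x + b)) (at x)"
      by (rule vector_diff_chain_at) (rule test_functions_has_vector_derivative[OF assms(1)])
    then have "(F k has_vector_derivative of_real (a ^ k) * (a *\<^sub>R nth_deriv (Suc k) \<phi> (a * x + b))) (at x)"
      unfolding F_def o_def by (rule has_vector_derivative_mult_right)
    then show ?thesis
      by (simp add: F_def scaleR_conv_of_real mult_ac)
  qed
  show "nth_deriv k (\<lambda>x. \<phi> (a * x + b)) = (\<lambda>x. of_real (a ^ k) * nth_deriv k \<phi> (a * x + b))"
    using nth_deriv_eqI[of F, OF F0 FS] by (simp add: F_def)
  \<comment> \<open>The support is pulled back along the inverse affine map, which exists since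
    \<open>a \<noteq> 0\<close> and keeps bounded sets bounded.\<close>
  have "{x. \<phi> (a * x + b) \<noteq> 0} \<subseteq> (\<lambda>y. (1 / a) *\<^sub>R (y - b)) ` {y. \<phi> y \<noteq> 0}"
    using assms(2) by (force simp: image_iff field_simps)
  moreover have "bounded ((\<lambda>y. (1 / a) *\<^sub>R (y - b)) ` {y. \<phi> y \<noteq> 0})"
    using bounded_scaling[OF bounded_translation_minus[of "{y. \<phi> y \<noteq> 0}" b], of "1 / a"] assms(1)
    by (simp add: test_functions_iff image_image)
  ultimately have "bounded {x. \<phi> (a * x + b) \<noteq> 0}"
    by (rule bounded_subset[rotated])
  then show "(\<lambda>x. \<phi> (a * x + b)) \<in> test_functions"
    using test_functionsI[of F, OF F0 FS] by blast
qed

lemma test_functions_cnj: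
  assumes "\<phi> \<in> test_functions"
  shows "(\<lambda>x. cnj (\<phi> x)) \<in> test_functions"
proof (rule test_functionsI)
  show "((\<lambda>x. cnj (nth_deriv k \<phi> x)) has_vector_derivative cnj (nth_deriv (Suc k) \<phi> x)) (at x)" for k x
    by (intro has_vector_derivative_cnj test_functions_has_vector_derivative assms)
qed (use assms in \<open>auto simp: test_functions_iff\<close>)

text \<open>On an open set the derivative of a vanishing function is determined by the values there.
  Thanks to this, seminorms need estimating only on a compact set that contains the support.\<close>

lemma nth_deriv_eq_0_on_open:
  assumes "\<phi> \<in> test_functions" "open S" "\<And>x. x \<in> S \<Longrightarrow> \<phi> x = 0" "x \<in> S"
  shows "nth_deriv k \<phi> x = 0"
  using assms(4)
proof (induction k arbitrary: x)
  case (Suc k)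
  have "((\<lambda>x. 0) has_vector_derivative nth_deriv (Suc k) \<phi> x) (at x)"
    by (rule has_vector_derivative_transform_within_open
        [OF test_functions_has_vector_derivative[OF assms(1)] assms(2)])
      (use Suc in auto)
  then show ?case
    by (rule vector_derivative_unique_at[OF _ has_vector_derivative_const])
qed (use assms in simp)

lemma integrable_test_function:
  assumes "\<phi> \<in> test_functions"
  shows "integrable lborel \<phi>"
proof -
  let ?K = "closure {x. \<phi> x \<noteq> 0}"
  have "integrable lborel (\<lambda>x. indicator ?K x *\<^sub>R \<phi> x)"
    using assms continuous_on_nth_deriv[OF assms, of ?K 0]
    by (intro borel_integrable_compact) (auto simp: test_functions_def)
  moreover have "(\<lambda>x. indicator ?K x *\<^sub>R \<phi> x) = \<phi>"
  proof
    show "indicator ?K x *\<^sub>R \<phi> x = \<phi> x" for x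
      using closure_subset[of "{x. \<phi> x \<noteq> 0}"] by (cases "\<phi> x = 0") auto
  qed
  ultimately show ?thesis by simp
qed

section \<open>Bump functions\<close>

text \<open>Differentiating first and recursing on the derivative lets closure under sums and
  products follow by induction with the functions arbitrary, without a Leibniz formula for higher
  derivatives.\<close>

primrec times_differentiable :: "nat \<Rightarrow> (real \<Rightarrow> complex) \<Rightarrow> bool" where
  "times_differentiable 0 f \<longleftrightarrow> True"
| "times_differentiable (Suc n) f \<longleftrightarrow>
     (\<forall>x. f differentiable (at x)) \<and> times_differentiable n (\<lambda>x. vector_derivative f (at x))"

lemma times_differentiable_iff_nth_deriv:
  "times_differentiable n f \<longleftrightarrow> (\<forall>k<n. \<forall>x. nth_deriv k f differentiable (at x))"
  by (induction n arbitrary: f) (auto simp: less_Suc_eq_0_disj nth_deriv_Suc2)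

lemma times_differentiable_SucD: "times_differentiable (Suc n) f \<Longrightarrow> times_differentiable n f"
  by (simp add: times_differentiable_iff_nth_deriv del: times_differentiable.simps)

lemma times_differentiable_add:
  assumes "times_differentiable n f" "times_differentiable n g"
  shows "times_differentiable n (\<lambda>x. f x + g x)"
  using assms
proof (induction n arbitrary: f g)
  case (Suc n)
  then have "(\<lambda>x. vector_derivative (\<lambda>x. f x + g x) (at x)) =
      (\<lambda>x. vector_derivative f (at x) + vector_derivative g (at x))"
    by (auto intro!: ext vector_derivative_at has_vector_derivative_add simp: vector_derivative_works)
  with Suc show ?case by simp
qed simp

lemma times_differentiable_mult:
  assumes "times_differentiable n f" "times_differentiable n g"
  shows "times_differentiable n (\<lambda>x. f x * g x)"
  using assms
proof (induction n arbitrary: f g)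
  case (Suc n)
  then have "(\<lambda>x. vector_derivative (\<lambda>x. f x * g x) (at x)) =
      (\<lambda>x. f x * vector_derivative g (at x) + vector_derivative f (at x) * g x)"
    by (auto intro!: ext vector_derivative_at has_vector_derivative_mult simp: vector_derivative_works)
  \<comment> \<open>The product rule pairs each function with the derivative of the other, so the
    induction hypothesis is applied to the functions themselves as well.\<close>
  moreover have "times_differentiable n f" "times_differentiable n g"
    using Suc.prems by (auto intro: times_differentiable_SucD simp del: times_differentiable.simps)
  ultimately show ?case
    using Suc by (simp add: times_differentiable_add)
qed simp

text \<open>The classical smooth function exp(-1/x), extended by 0. The polynomial in 1/x makes the
  family closed under differentiation.\<close>

definition flat :: "real poly \<Rightarrow> real \<Rightarrow> real" where
  "flat p x = (if x > 0 then poly p (1 / x) * exp (- (1 / x)) else 0)"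

lemma tendsto_poly_exp_neg:
  fixes p :: "real poly"
  shows "((\<lambda>t. poly p t * exp (- t)) \<longlongrightarrow> 0) at_top"
proof -
  have "((\<lambda>t. \<Sum>i\<le>degree p. coeff p i * (t ^ i / exp t)) \<longlongrightarrow> (\<Sum>i\<le>degree p. coeff p i * 0)) at_top"
    by (intro tendsto_intros tendsto_power_div_exp_0)
  then show ?thesis
    by (simp add: poly_altdef sum_distrib_right exp_minus divide_inverse mult.assoc)
qed

text \<open>With s = 1/x, the derivative of p(s) exp(-s) in x is s^2 (p(s) - p'(s)) exp(-s), and
  \<open>[:0, 0, 1:]\<close> is s^2. At the origin both one-sided difference quotients tend to
  0.\<close>

lemma flat_has_real_derivative:
  "(flat p has_real_derivative flat ([:0, 0, 1:] * (p - pderiv p)) x) (at x)"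
proof -
  consider "x > 0" | "x < 0" | "x = 0" by linarith
  then show ?thesis
  proof cases
    case 1
    have "((\<lambda>x. poly p (1 / x) * exp (- (1 / x))) has_real_derivative
        flat ([:0, 0, 1:] * (p - pderiv p)) x) (at x)"
      using 1 by (auto intro!: derivative_eq_intros simp: flat_def field_simps power2_eq_square)
    then show ?thesis
      by (rule has_field_derivative_transform_within_open[where S = "{0<..}"])
         (use 1 in \<open>auto simp: flat_def\<close>)
  next
    case 2
    have "((\<lambda>x. 0) has_real_derivative flat ([:0, 0, 1:] * (p - pderiv p)) x) (at x)"
      using 2 by (simp add: flat_def)
    then show ?thesis
      by (rule has_field_derivative_transform_within_open[where S = "{..<0}"])
         (use 2 in \<open>auto simp: flat_def\<close>)
  next
    case 3
    \<comment> \<open>Dividing by h multiplies by s = 1/h, and \<open>pCons 0 p\<close> is the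
      polynomial s p(s).\<close>
    have "((\<lambda>h. poly (pCons 0 p) (inverse h) * exp (- inverse h)) \<longlongrightarrow> 0) (at_right 0)"
      by (rule filterlim_compose[OF tendsto_poly_exp_neg filterlim_inverse_at_top_right])
    then have "((\<lambda>h. flat p h / h) \<longlongrightarrow> 0) (at_right 0)"
      by (rule Lim_transform_eventually)
         (auto simp: eventually_at_right_field flat_def divide_inverse intro!: exI[of _ 1])
    moreover have "((\<lambda>h. flat p h / h) \<longlongrightarrow> 0) (at_left 0)"
      by (rule Lim_transform_eventually[OF tendsto_const])
         (auto simp: eventually_at_left_field flat_def intro!: exI[of _ "-1"])
    ultimately show ?thesis
      unfolding 3 has_field_derivative_iff
      by (simp add: flat_def filterlim_split_at)
  qed
qed

text \<open>The derivative is again of this form for another polynomial, which also absorbs the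
  chain rule factor \<open>c\<close>; hence the induction with \<open>p\<close> arbitrary.\<close>

lemma times_differentiable_flat: "times_differentiable n (\<lambda>x. of_real (flat p (c * x + d)))"
proof (induction n arbitrary: p)
  case (Suc n)
  let ?q = "smult c ([:0, 0, 1:] * (p - pderiv p))"
  have "((\<lambda>x. complex_of_real (flat p (c * x + d))) has_vector_derivative
      of_real (flat ?q (c * x + d))) (at x)" for x
  proof -
    have "((\<lambda>x. c * x + d) has_real_derivative c) (at x)"
      by (auto intro!: derivative_eq_intros)
    from DERIV_chain2[OF flat_has_real_derivative[of p] this]
    have "((\<lambda>x. flat p (c * x + d)) has_vector_derivative
        flat ([:0, 0, 1:] * (p - pderiv p)) (c * x + d) * c) (at x)"
      by (simp only: has_real_derivative_iff_has_vector_derivative)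
    moreover have "flat ([:0, 0, 1:] * (p - pderiv p)) t * c = flat ?q t" for t
      by (simp add: flat_def)
    ultimately show ?thesis
      by (intro has_vector_derivative_of_real) (simp only: has_real_derivative_iff_has_vector_derivative)
  qed
  note D = this
  have "(\<lambda>x. vector_derivative (\<lambda>x. complex_of_real (flat p (c * x + d))) (at x)) =
      (\<lambda>x. of_real (flat ?q (c * x + d)))"
    using vector_derivative_at[OF D] by (rule ext)
  moreover have "(\<lambda>x. complex_of_real (flat p (c * x + d))) differentiable (at x)" for x
    using D by (rule differentiableI_vector)
  ultimately show ?case
    using Suc[of ?q] by (simp del: mult_pCons_left)
qed simp

text \<open>Reflection swaps the two factors \<open>flat 1 (a - x)\<close> and
  \<open>flat 1 (a + x)\<close>, and one of them vanishes outside [-a, a]. For |x| \<le> R both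
  arguments are at least 1, so by monotonicity division by \<open>m\<^sup>2\<close> leaves a value
  of at least 1.\<close>

lemma ex_even_bump:
  obtains \<eta> where "(\<lambda>x. complex_of_real (\<eta> x)) \<in> test_functions"
    "\<And>x. \<eta> x \<ge> 0" "\<And>x. \<bar>x\<bar> \<le> R \<Longrightarrow> \<eta> x \<ge> 1" "\<And>x. \<eta> (- x) = \<eta> x"
proof -
  define a where "a = \<bar>R\<bar> + 1"
  define m where "m = flat 1 1"
  define \<eta> where "\<eta> x = flat 1 (a - x) * flat 1 (a + x) / m\<^sup>2" for x
  have m: "m > 0" by (simp add: m_def flat_def)
  have mono: "flat 1 s \<le> flat 1 t" if "s \<le> t" for s t
    using that by (auto simp: flat_def frac_le)
  have nonneg: "flat 1 t \<ge> 0" for t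
    by (simp add: flat_def)
  show ?thesis
  proof
    show "\<eta> x \<ge> 0" for x
      using nonneg by (simp add: \<eta>_def)
    show "\<eta> (- x) = \<eta> x" for x
      by (simp add: \<eta>_def mult.commute)
    show "\<eta> x \<ge> 1" if "\<bar>x\<bar> \<le> R" for x
    proof -
      have "m * m \<le> flat 1 (a - x) * flat 1 (a + x)"
        unfolding m_def using that by (intro mult_mono mono nonneg) (auto simp: a_def)
      then show ?thesis
        using m by (simp add: \<eta>_def power2_eq_square field_simps)
    qed
    have eq: "complex_of_real (\<eta> x) =
        of_real (1 / m\<^sup>2) * (of_real (flat 1 ((- 1) * x + a)) * of_real (flat 1 (1 * x + a)))" for x
      by (simp add: \<eta>_def add.commute)
    have const: "times_differentiable n (\<lambda>x. c)" for n c
      by (induction n arbitrary: c) auto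
    have "times_differentiable n (\<lambda>x. complex_of_real (\<eta> x))" for n
      unfolding eq by (intro times_differentiable_mult times_differentiable_flat const)
    then have "\<forall>k x. nth_deriv k (\<lambda>x. complex_of_real (\<eta> x)) differentiable (at x)"
      unfolding times_differentiable_iff_nth_deriv by blast
    moreover have "{x. complex_of_real (\<eta> x) \<noteq> 0} \<subseteq> {-a..a}"
      by (auto simp: \<eta>_def flat_def split: if_splits)
    then have "bounded {x. complex_of_real (\<eta> x) \<noteq> 0}"
      using bounded_closed_interval bounded_subset by blast
    ultimately show "(\<lambda>x. complex_of_real (\<eta> x)) \<in> test_functions"
      by (simp add: test_functions_iff)
  qed
qed

section \<open>Croft's lemma\<close>

text \<open>If convergence fails, \<open>h\<close> stays away from \<open>L\<close> on an unbounded
  open set \<open>U\<close>. By Baire's theorem some \<open>c\<close> in [1, 2] has infinitely many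
  integer multiples in \<open>U\<close>, against the limit along the multiples of
  \<open>c\<close>.\<close>

lemma Croft:
  fixes h :: "real \<Rightarrow> 'a :: metric_space"
  assumes cont: "continuous_on {0<..} h"
    and lim: "\<And>c. c > 0 \<Longrightarrow> (\<lambda>n. h (real n * c)) \<longlonglongrightarrow> L"
  shows "(h \<longlongrightarrow> L) at_top"
proof (rule ccontr)
  assume "\<not> ?thesis"
  then obtain e where e: "e > 0" "\<not> (\<forall>\<^sub>F t in at_top. dist (h t) L < e)"
    unfolding tendsto_iff by blast
  \<comment> \<open>Half of \<open>e\<close> leaves room to use the complement of a closed ball: it
    is open, yet contains every value at distance at least \<open>e\<close> from
    \<open>L\<close>.\<close>
  define U where "U = {t\<in>{0<..}. h t \<in> - cball L (e / 2)}"
  have "open U"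
    unfolding U_def by (rule continuous_open_preimage[OF cont, unfolded vimage_def Int_def mem_Collect_eq]) auto
  have unb: "\<exists>t\<ge>T. t \<in> U" for T
  proof -
    from e(2) obtain t where "t \<ge> max T 1" "\<not> dist (h t) L < e"
      unfolding eventually_at_top_linorder by blast
    with e(1) show ?thesis
      by (intro exI[of _ t]) (auto simp: U_def dist_commute)
  qed
  let ?S = "{1..2::real}"
  \<comment> \<open>A point common to all \<open>V N\<close> has multiples in \<open>U\<close> of
    arbitrarily large index.\<close>
  define V where "V N = {t\<in>?S. \<exists>n\<ge>N. real n * t \<in> U}" for N :: nat
  have V: "openin (top_of_set ?S) (V N) \<and> ?S \<subseteq> closure (V N)" for N
  proof
    have "open (\<Union>n\<in>{N..}. (\<lambda>t. real n * t) -` U)"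
      by (intro open_UN ballI open_vimage \<open>open U\<close> continuous_intros)
    moreover have "V N = ?S \<inter> (\<Union>n\<in>{N..}. (\<lambda>t. real n * t) -` U)"
      by (auto simp: V_def)
    ultimately show "openin (top_of_set ?S) (V N)"
      by (auto simp: openin_open)
    have "{1<..<2} \<subseteq> closure (V N)"
    proof
      fix x :: real assume x: "x \<in> {1<..<2}"
      show "x \<in> closure (V N)"
        unfolding closure_approachable
      proof (intro allI impI)
        fix d :: real assume "d > 0"
        define b where "b = min (x + d) 2"
        have b: "x < b" "b \<le> 2" "b \<le> x + d" using x \<open>d > 0\<close> by (auto simp: b_def)
        \<comment> \<open>For such \<open>t\<close> the interval \<open>(t / b, t / x)\<close> is longer than \<open>1\<close>, so contains an integer \<open>n\<close>.\<close>
        obtain t where t: "t \<ge> max (real N * b) (1 / (1 / x - 1 / b) + 1)" "t \<in> U"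
          using unb by blast
        have gap: "1 / x - 1 / b > 0" using b x by (simp add: field_simps)
        \<comment> \<open>The least integer above t/b. It exceeds t/b by at most 1, hence lies below
          t/x, which puts t/n between \<open>x\<close> and \<open>b\<close>.\<close>
        define n where "n = nat (\<lfloor>t / b\<rfloor> + 1)"
        have t0: "t > 0" using t(2) by (simp add: U_def)
        have n: "real n > t / b" "real n \<le> t / b + 1"
          using t0 b x by (auto simp: n_def)
        have "t * (1 / x - 1 / b) > 1"
          using mult_right_mono[of "1 / (1 / x - 1 / b) + 1" t "1 / x - 1 / b"] t(1) gap
          by (simp add: distrib_right split: if_splits)
        then have "real n < t / x"
          using n by (simp add: right_diff_distrib)
        moreover have "real n > 0"
          using n(1) divide_pos_pos[of t b] t0 b x by (smt (verit) greaterThanLessThan_iff)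
        ultimately have "x < t / real n" "t / real n < b"
          using n(1) x b by (auto simp: field_simps)
        moreover have "n \<ge> N"
        proof -
          have "real N \<le> t / b" using t(1) b x by (simp add: field_simps)
          then show ?thesis using n(1) by linarith
        qed
        moreover from calculation have "1 \<le> t / real n" "t / real n \<le> 2"
          using b x by auto
        ultimately have "t / real n \<in> V N" "dist (t / real n) x < d"
          using b x t(2) \<open>real n > 0\<close>
          by (auto simp: V_def dist_real_def simp del: le_divide_eq_1 divide_le_eq_1 intro!: exI[of _ n])
        then show "\<exists>y\<in>V N. dist y x < d" by blast
      qed
    qed
    then have "closure {1<..<2} \<subseteq> closure (V N)"
      by (rule closure_minimal) (rule closed_closure)
    moreover have "closure {1<..<2} = ?S" by simp
    ultimately show "?S \<subseteq> closure (V N)" by (simp only:)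
  qed
  have "?S \<subseteq> closure (\<Inter>(range V))"
    by (rule Baire) (use V in auto)
  then have "\<Inter>(range V) \<noteq> {}" by (intro notI) simp
  then obtain c where c: "\<And>N. c \<in> V N" by auto
  from c[of 0] have "c > 0" by (simp add: V_def)
  have "\<forall>\<^sub>F n in sequentially. dist (h (real n * c)) L < e / 2"
    using lim[OF \<open>c > 0\<close>] e(1) by (intro tendstoD) auto
  then obtain N where N: "\<And>n. n \<ge> N \<Longrightarrow> dist (h (real n * c)) L < e / 2"
    unfolding eventually_sequentially by blast
  obtain n where "n \<ge> N" "real n * c \<in> U"
    using c[of N] by (auto simp: V_def)
  with N[of n] show False
    by (auto simp: U_def dist_commute)
qed


section \<open>Dilations of a distribution\<close>

text \<open>For t > 0 this is the function h of the overview, with \<open>t\<close> as the Jacobian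
  factor. The parameter is the reciprocal of the scale \<epsilon>, so at integers it is the index of
  the delta sequence.\<close>

definition zoom :: "((real \<Rightarrow> complex) \<Rightarrow> complex) \<Rightarrow> real \<Rightarrow> (real \<Rightarrow> complex) \<Rightarrow> real \<Rightarrow> complex" where
  "zoom f x0 \<phi> t = of_real t * f (\<lambda>y. \<phi> (t * (y - x0)))"

definition even_part :: "(real \<Rightarrow> complex) \<Rightarrow> real \<Rightarrow> complex" where
  "even_part \<phi> x = (1 / 2) * \<phi> x + (1 / 2) * \<phi> (- x)"

lemma distribution_lincomb:
  assumes "f \<in> distributions" "\<phi> \<in> test_functions" "\<psi> \<in> test_functions"
  shows "f (\<lambda>x. a * \<phi> x + b * \<psi> x) = a * f \<phi> + b * f \<psi>"
  using assms unfolding distributions_def by blast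

lemma test_functions_zoom:
  assumes "\<phi> \<in> test_functions" "t \<noteq> 0"
  shows "(\<lambda>y. \<phi> (t * (y - x0))) \<in> test_functions"
  using test_functions_affine[OF assms, of "- t * x0"] by (simp add: algebra_simps)

lemma nth_deriv_zoom:
  assumes "\<phi> \<in> test_functions" "t \<noteq> 0"
  shows "nth_deriv k (\<lambda>y. \<phi> (t * (y - x0))) = (\<lambda>y. of_real (t ^ k) * nth_deriv k \<phi> (t * (y - x0)))"
  using nth_deriv_affine[OF assms, of k "- t * x0"] by (simp add: algebra_simps)

lemma test_functions_reflect: "\<phi> \<in> test_functions \<Longrightarrow> (\<lambda>x. \<phi> (- x)) \<in> test_functions"
  using test_functions_affine[of \<phi> "-1" 0] by simp

lemma test_functions_even_part: "\<phi> \<in> test_functions \<Longrightarrow> even_part \<phi> \<in> test_functions"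
  unfolding even_part_def[abs_def] by (intro test_functions_lincomb test_functions_reflect)

lemma zoom_lincomb:
  assumes "f \<in> distributions" "\<phi> \<in> test_functions" "\<psi> \<in> test_functions" "t \<noteq> 0"
  shows "zoom f x0 (\<lambda>x. a * \<phi> x + b * \<psi> x) t = a * zoom f x0 \<phi> t + b * zoom f x0 \<psi> t"
  unfolding zoom_def
  by (subst distribution_lincomb[OF assms(1) test_functions_zoom test_functions_zoom])
     (use assms in \<open>auto simp: algebra_simps\<close>)

lemma zoom_delta_seq:
  assumes "f \<in> distributions" "\<phi> \<in> test_functions" "n > 0"
  shows "affine_change f x0 1 (delta_seq \<phi> n) = zoom f x0 \<phi> (real n)"
proof -
  have "(\<lambda>y. \<phi> (real n * (y - x0))) \<in> test_functions"
    using assms by (intro test_functions_zoom) auto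
  from distribution_lincomb[OF assms(1) this this, of "of_nat n" 0] show ?thesis
    by (simp add: affine_change_def delta_seq_def zoom_def)
qed

text \<open>Changing the sign of \<epsilon> amounts to reflecting the test function, so the mean
  over both signs passes to the even part of \<phi> and depends only on the absolute value of
  \<epsilon>.\<close>

lemma symmetric_mean_eq_zoom:
  assumes "f \<in> distributions" "\<phi> \<in> test_functions" "\<epsilon> \<noteq> 0"
  shows "(affine_change f x0 \<epsilon> \<phi> + affine_change f x0 (- \<epsilon>) \<phi>) / 2 =
    zoom f x0 (even_part \<phi>) (inverse \<bar>\<epsilon>\<bar>)"
proof -
  have *: "zoom f x0 (even_part \<phi>) (inverse \<bar>\<epsilon>\<bar>) =
      (1 / 2) * zoom f x0 \<phi> (inverse \<bar>\<epsilon>\<bar>) + (1 / 2) * zoom f x0 (\<lambda>x. \<phi> (- x)) (inverse \<bar>\<epsilon>\<bar>)"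
    unfolding even_part_def[abs_def] using assms(3)
    by (intro zoom_lincomb test_functions_reflect assms) auto
  have pos: "affine_change f x0 e \<phi> = zoom f x0 \<phi> (inverse e)"
    and neg: "affine_change f x0 (- e) \<phi> = zoom f x0 (\<lambda>x. \<phi> (- x)) (inverse e)" if "e > 0" for e
    using that by (simp_all add: zoom_def affine_change_def divide_inverse mult.commute)
  show ?thesis
  proof (cases "\<epsilon> > 0")
    case True
    then show ?thesis unfolding * pos[OF True] neg[OF True] by simp
  next
    case False
    with assms(3) have "- \<epsilon> > 0" by simp
    then show ?thesis
      using pos[of "- \<epsilon>"] neg[of "- \<epsilon>"] unfolding * by (simp add: add.commute)
  qed
qed

lemma has_symmetric_point_value_iff_zoom:
  assumes "f \<in> distributions"
  shows "has_symmetric_point_value f x0 \<gamma> \<longleftrightarrow>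
    (\<forall>\<phi>\<in>test_functions. ((\<lambda>\<epsilon>. zoom f x0 (even_part \<phi>) (inverse \<bar>\<epsilon>\<bar>))
       \<longlongrightarrow> \<gamma> * (LINT x|lborel. \<phi> x)) (at 0))"
  unfolding has_symmetric_point_value_def
proof (intro ball_cong filterlim_cong refl)
  fix \<phi> assume "\<phi> \<in> test_functions"
  then show "\<forall>\<^sub>F \<epsilon> in at 0. (affine_change f x0 \<epsilon> \<phi> + affine_change f x0 (- \<epsilon>) \<phi>) / 2 =
      zoom f x0 (even_part \<phi>) (inverse \<bar>\<epsilon>\<bar>)"
    unfolding eventually_at_filter
    by (intro always_eventually allI impI symmetric_mean_eq_zoom assms)
qed

text \<open>As s tends to t, the dilated test functions converge uniformly with each derivative, and
  their supports stay in one compact set. The seminorm estimate for that set carries this over to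
  the values of \<open>f\<close>.\<close>

lemma continuous_on_zoom:
  assumes f: "f \<in> distributions" and \<phi>: "\<phi> \<in> test_functions"
  shows "continuous_on {0<..} (zoom f x0 \<phi>)"
proof -
  have "((\<lambda>s. f (\<lambda>y. \<phi> (s * (y - x0)))) \<longlongrightarrow> f (\<lambda>y. \<phi> (t * (y - x0)))) (at t)"
    if t: "t > 0" for t
  proof (rule tendstoI)
    fix e :: real assume e: "e > 0"
    obtain R where R: "R > 0" "\<And>x. \<phi> x \<noteq> 0 \<Longrightarrow> \<bar>x\<bar> \<le> R"
      using \<phi> unfolding test_functions_iff bounded_pos by auto
    \<comment> \<open>For s \<ge> t/2, a nonzero \<phi> (s (y - x0)) forces |y - x0| \<le> R/s \<le>
      2R/t.\<close>
    define K where "K = {x0 - 2 * R / t..x0 + 2 * R / t}"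
    have [simp]: "compact K" by (simp add: K_def)
    obtain N C where C: "\<And>\<psi> B. \<psi> \<in> test_functions_on K \<Longrightarrow> B > 0 \<Longrightarrow>
        (\<forall>k\<le>N. \<forall>x. cmod (nth_deriv k \<psi> x) \<le> B) \<Longrightarrow> cmod (f \<psi>) \<le> C * B"
      using f \<open>compact K\<close> unfolding distributions_iff_seminorm_estimate by meson
    \<comment> \<open>The denominator |C| + 1 is positive and makes \<open>C * B < e\<close> strict
      for any sign of \<open>C\<close>.\<close>
    define B where "B = e / (\<bar>C\<bar> + 1)"
    have B: "B > 0" "C * B < e"
      using e by (auto simp: B_def field_simps abs_if)
    \<comment> \<open>The k-th derivative in y of the dilation by s, taken as a function of both
      variables: uniform continuity on a compact rectangle gives closeness uniform in y.\<close>
    define F where "F k = (\<lambda>(s, y). complex_of_real (s ^ k) * nth_deriv k \<phi> (s * (y - x0)))" for k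
    have "\<forall>\<^sub>F s in at t. \<forall>y\<in>K. cmod (F k (s, y) - F k (t, y)) < B" for k
    proof -
      have "continuous_on ({t / 2..2 * t} \<times> K) (F k)"
        unfolding F_def split_beta
        by (intro continuous_intros continuous_on_compose2[OF continuous_on_nth_deriv[OF \<phi>, of UNIV]]) auto
      then have "uniformly_continuous_on ({t / 2..2 * t} \<times> K) (F k)"
        by (intro compact_uniformly_continuous compact_Times) auto
      then obtain d where d: "d > 0" "\<And>p q. p \<in> {t / 2..2 * t} \<times> K \<Longrightarrow> q \<in> {t / 2..2 * t} \<times> K \<Longrightarrow>
          dist q p < d \<Longrightarrow> dist (F k q) (F k p) < B"
        using B(1) unfolding uniformly_continuous_on_def by meson
      have "\<forall>\<^sub>F s in at t. dist s t < min d (t / 2)"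
        unfolding eventually_at using d(1) t by (intro exI[of _ "min d (t / 2)"]) auto
      then show ?thesis
      proof eventually_elim
        case (elim s)
        then have "s \<in> {t / 2..2 * t}" "dist s t < d"
          unfolding dist_real_def atLeastAtMost_iff by linarith+
        then show ?case
          using d(2)[of "(t, y)" "(s, y)" for y] t by (auto simp: dist_Pair_Pair dist_norm[where 'a = complex])
      qed
    qed
    then have "\<forall>\<^sub>F s in at t. \<forall>k\<in>{..N}. \<forall>y\<in>K. cmod (F k (s, y) - F k (t, y)) < B"
      by (intro eventually_ball_finite) auto
    moreover have "\<forall>\<^sub>F s in at t. dist s t < t / 2"
      unfolding eventually_at using t by (intro exI[of _ "t / 2"]) auto
    ultimately show "\<forall>\<^sub>F s in at t. dist (f (\<lambda>y. \<phi> (s * (y - x0)))) (f (\<lambda>y. \<phi> (t * (y - x0)))) < e"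
    proof eventually_elim
      case (elim s)
      have s: "s > t / 2" using elim(2) unfolding dist_real_def by linarith
      then have s0: "s \<noteq> 0" "t \<noteq> 0" using t by auto
      note test = test_functions_zoom[OF \<phi> s0(1)] test_functions_zoom[OF \<phi> s0(2)]
      define \<psi> where "\<psi> = (\<lambda>y. 1 * \<phi> (s * (y - x0)) + (- 1) * \<phi> (t * (y - x0)))"
      have \<psi>: "\<psi> \<in> test_functions"
        unfolding \<psi>_def by (intro test_functions_lincomb test)
      have zero: "\<phi> (r * (y - x0)) = 0" if "y \<notin> K" "r \<ge> t / 2" for r y
      proof (rule ccontr)
        assume "\<phi> (r * (y - x0)) \<noteq> 0"
        then have "\<bar>r * (y - x0)\<bar> \<le> R" by (rule R(2))
        moreover have "t / 2 * \<bar>y - x0\<bar> \<le> \<bar>r * (y - x0)\<bar>"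
          unfolding abs_mult using that t by (intro mult_right_mono) auto
        ultimately have "\<bar>y - x0\<bar> \<le> 2 * R / t" using t by (simp add: field_simps)
        then show False using that(1) by (auto simp: K_def)
      qed
      have \<psi>0: "\<psi> y = 0" if "y \<notin> K" for y
        using zero[OF that, of s] zero[OF that, of t] s t by (simp add: \<psi>_def)
      have "closure {y. \<psi> y \<noteq> 0} \<subseteq> K"
        by (rule closure_minimal) (use \<psi>0 in \<open>auto simp: compact_imp_closed\<close>)
      then have "\<psi> \<in> test_functions_on K"
        using \<psi> by (simp add: test_functions_on_def)
      \<comment> \<open>On \<open>K\<close> this is the closeness of \<open>F k\<close> at s and t;
        off \<open>K\<close>, \<psi> vanishes on an open set, and so do its derivatives.\<close>
      moreover have "cmod (nth_deriv k \<psi> y) \<le> B" if "k \<le> N" for k y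
      proof (cases "y \<in> K")
        case True
        then show ?thesis
          using elim(1) that s0 unfolding \<psi>_def nth_deriv_lincomb[OF test]
          by (auto simp: F_def nth_deriv_zoom[OF \<phi>] intro!: less_imp_le)
      next
        case False
        then show ?thesis
          using nth_deriv_eq_0_on_open[OF \<psi>, of "- K" y k] \<psi>0 B(1)
          by (simp add: open_Compl compact_imp_closed)
      qed
      ultimately have "cmod (f \<psi>) \<le> C * B"
        using C B(1) by blast
      then show ?case
        using B(2) distribution_lincomb[OF f test, of 1 x0 "- 1" x0] by (simp add: \<psi>_def dist_norm)
    qed
  qed
  then have "continuous_on {0<..} (\<lambda>t. f (\<lambda>y. \<phi> (t * (y - x0))))"
    by (intro continuous_at_imp_continuous_on ballI) (simp add: isCont_def)
  then show ?thesis
    unfolding zoom_def by (intro continuous_intros)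
qed

section \<open>From positive to arbitrary even test functions\<close>

text \<open>Both sides are linear in \<phi>. Scaling covers nonnegative even functions of positive
  integral, differences of such functions cover the real ones, and real and imaginary parts cover
  the rest.\<close>

lemma zoom_tendsto_even:
  assumes f: "f \<in> distributions"
    and hyp: "\<forall>\<phi>\<in>test_functions. positive_fun \<phi> \<and> normalized_fun \<phi> \<and> even_fun \<phi> \<longrightarrow>
            (\<lambda>n. affine_change f x0 1 (delta_seq \<phi> n)) \<longlonglongrightarrow> \<gamma>"
    and \<phi>: "\<phi> \<in> test_functions" "even_fun \<phi>"
  shows "(\<lambda>n. zoom f x0 \<phi> (real n)) \<longlonglongrightarrow> \<gamma> * (LINT x|lborel. \<phi> x)"
proof -
  let ?c = "\<lambda>r x. complex_of_real (r x)"
  have lincomb: "(\<lambda>n. zoom f x0 (\<lambda>x. a * \<phi> x + b * \<psi> x) (real n)) \<longlonglongrightarrow> a * u + b * v"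
    if "\<phi> \<in> test_functions" "\<psi> \<in> test_functions" "(\<lambda>n. zoom f x0 \<phi> (real n)) \<longlonglongrightarrow> u"
      "(\<lambda>n. zoom f x0 \<psi> (real n)) \<longlonglongrightarrow> v" for \<phi> \<psi> a b u v
  proof (rule Lim_transform_eventually)
    show "(\<lambda>n. a * zoom f x0 \<phi> (real n) + b * zoom f x0 \<psi> (real n)) \<longlonglongrightarrow> a * u + b * v"
      by (intro tendsto_intros that)
    show "\<forall>\<^sub>F n in sequentially. a * zoom f x0 \<phi> (real n) + b * zoom f x0 \<psi> (real n) =
        zoom f x0 (\<lambda>x. a * \<phi> x + b * \<psi> x) (real n)"
      using eventually_gt_at_top[of 0] by eventually_elim (simp add: zoom_lincomb[OF f that(1,2)])
  qed
  have int: "integrable lborel r" if "?c r \<in> test_functions" for r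
    using integrable_Re[OF integrable_test_function[OF that]] by simp
  have pos: "(\<lambda>n. zoom f x0 (?c r) (real n)) \<longlonglongrightarrow> \<gamma> * of_real (LINT x|lborel. r x)"
    if r: "?c r \<in> test_functions" "\<And>x. r x \<ge> 0" "\<And>x. r (- x) = r x" "(LINT x|lborel. r x) > 0" for r
  proof -
    define J where "J = (LINT x|lborel. r x)"
    define \<psi> where "\<psi> = (\<lambda>x. of_real (1 / J) * ?c r x + 0 * ?c r x)"
    have J: "J > 0" using r(4) by (simp add: J_def)
    have \<psi>: "\<psi> \<in> test_functions"
      unfolding \<psi>_def by (intro test_functions_lincomb r)
    have "\<psi> = ?c (\<lambda>x. r x / J)" by (simp add: \<psi>_def)
    then have "(LINT x|lborel. \<psi> x) = of_real (LINT x|lborel. r x / J)"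
      by (simp only: integral_complex_of_real)
    also have "\<dots> = 1" using J by (simp add: J_def)
    finally have "normalized_fun \<psi>" by (simp add: normalized_fun_def)
    moreover have "positive_fun \<psi>" "even_fun \<psi>"
      using r J by (auto simp: positive_fun_def even_fun_def \<psi>_def nonneg_Reals_of_real_iff
          simp flip: of_real_divide)
    ultimately have "(\<lambda>n. affine_change f x0 1 (delta_seq \<psi> n)) \<longlonglongrightarrow> \<gamma>"
      using hyp \<psi> by blast
    then have "(\<lambda>n. zoom f x0 \<psi> (real n)) \<longlonglongrightarrow> \<gamma>"
      by (rule Lim_transform_eventually)
        (use eventually_gt_at_top[of 0] in eventually_elim, simp add: zoom_delta_seq[OF f \<psi>])
    from lincomb[OF \<psi> \<psi> this this, of "of_real J" 0] show ?thesis
      using J by (simp add: \<psi>_def J_def[symmetric] mult.commute)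
  qed
  have real: "(\<lambda>n. zoom f x0 (?c r) (real n)) \<longlonglongrightarrow> \<gamma> * of_real (LINT x|lborel. r x)"
    if r: "?c r \<in> test_functions" "\<And>x. r (- x) = r x" for r
  proof -
    obtain R where R: "R > 0" "\<And>x. r x \<noteq> 0 \<Longrightarrow> \<bar>x\<bar> \<le> R"
      using r(1) unfolding test_functions_iff bounded_pos by auto
    have "compact (r ` {-R..R})"
      using continuous_on_Re[OF continuous_on_nth_deriv[OF r(1), of "{-R..R}" 0]]
      by (intro compact_continuous_image) auto
    then have "bounded (r ` {-R..R})"
      by (rule compact_imp_bounded)
    then obtain M where M: "M > 0" "\<forall>y\<in>r ` {-R..R}. norm y \<le> M"
      unfolding bounded_pos by auto
    \<comment> \<open>The radius R makes \<eta> at least 1 wherever \<open>r\<close> is nonzero; the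
      radius 1 makes it dominate the indicator of [-1, 1], so its integral is positive.\<close>
    obtain \<eta> where \<eta>: "?c \<eta> \<in> test_functions" "\<And>x. \<eta> x \<ge> 0"
      "\<And>x. \<bar>x\<bar> \<le> max R 1 \<Longrightarrow> \<eta> x \<ge> 1" "\<And>x. \<eta> (- x) = \<eta> x"
      by (rule ex_even_bump[of "max R 1"]) blast
    have "integral\<^sup>L lborel (indicator {-1..1} :: real \<Rightarrow> real) \<le> integral\<^sup>L lborel \<eta>"
      by (rule integral_mono) (use int[OF \<eta>(1)] \<eta>(2,3) in \<open>auto simp: indicator_def\<close>)
    then have int\<eta>: "integral\<^sup>L lborel \<eta> > 0" by simp
    \<comment> \<open>The multiple M \<eta> outweighs a negative \<open>r\<close>; the additional
      \<eta> keeps \<open>s\<close> above \<eta>, which makes its integral positive.\<close>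
    define s where "s x = r x + (M + 1) * \<eta> x" for x
    have s: "s x \<ge> \<eta> x" for x
    proof (cases "\<bar>x\<bar> \<le> R")
      case True
      then have "M * 1 \<le> M * \<eta> x" using \<eta>(3)[of x] M(1) by (intro mult_left_mono) auto
      moreover have "\<bar>r x\<bar> \<le> M" using M(2) True by (auto simp: abs_le_iff)
      ultimately show ?thesis by (simp add: s_def algebra_simps)
    next
      case False
      then have "r x = 0" using R(2) by blast
      then show ?thesis using mult_nonneg_nonneg[of M "\<eta> x"] M(1) \<eta>(2)[of x]
        by (simp add: s_def algebra_simps)
    qed
    have ts: "?c s \<in> test_functions"
      using test_functions_lincomb[OF r(1) \<eta>(1), of 1 "of_real (M + 1)"] by (simp add: s_def)
    have s_even: "s (- x) = s x" for x
      by (simp add: s_def r(2) \<eta>(4))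
    have "integral\<^sup>L lborel \<eta> \<le> integral\<^sup>L lborel s"
      by (intro integral_mono int ts \<eta> s)
    then have "integral\<^sup>L lborel s > 0"
      using int\<eta> by linarith
    then have "(\<lambda>n. zoom f x0 (?c s) (real n)) \<longlonglongrightarrow> \<gamma> * of_real (LINT x|lborel. s x)"
      using order_trans[OF \<eta>(2) s] by (intro pos ts s_even)
    \<comment> \<open>Recovers \<open>r\<close> as s - (M + 1) \<eta>, a combination of two
      functions already covered.\<close>
    from lincomb[OF ts \<eta>(1) this pos[OF \<eta>(1,2,4) int\<eta>], of 1 "- of_real (M + 1)"]
    show ?thesis
      using int[OF r(1)] int[OF \<eta>(1)] by (simp add: s_def algebra_simps)
  qed
  have Re: "?c (\<lambda>x. Re (\<phi> x)) \<in> test_functions"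
    using test_functions_lincomb[OF \<phi>(1) test_functions_cnj[OF \<phi>(1)], of "1 / 2" "1 / 2"]
    by (rule back_subst[of "\<lambda>\<psi>. \<psi> \<in> test_functions"]) (auto simp: complex_eq_iff)
  have Im: "?c (\<lambda>x. Im (\<phi> x)) \<in> test_functions"
    using test_functions_lincomb[OF \<phi>(1) test_functions_cnj[OF \<phi>(1)], of "- \<i> / 2" "\<i> / 2"]
    by (rule back_subst[of "\<lambda>\<psi>. \<psi> \<in> test_functions"]) (auto simp: complex_eq_iff)
  have "(LINT x|lborel. \<phi> x) = of_real (LINT x|lborel. Re (\<phi> x)) + \<i> * of_real (LINT x|lborel. Im (\<phi> x))"
    using integrable_test_function[OF \<phi>(1)] by (simp add: complex_eq_iff)
  moreover have "\<phi> = (\<lambda>x. 1 * of_real (Re (\<phi> x)) + \<i> * of_real (Im (\<phi> x)))"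
    by (auto simp: complex_eq_iff)
  moreover note lincomb[OF Re Im real[OF Re] real[OF Im], of 1 \<i>]
  ultimately show ?thesis
    using \<phi>(2) by (simp add: even_fun_def algebra_simps)
qed

section \<open>Equivalence of the limit along the integers and the limit over all real
  scales\<close>

theorem proposition7p5:
  fixes f :: "(real \<Rightarrow> complex) \<Rightarrow> complex" and x0 :: real and \<gamma> :: complex
  assumes "f \<in> distributions"
  shows "(\<forall>\<phi>\<in>test_functions.
            positive_fun \<phi> \<and> normalized_fun \<phi> \<and> even_fun \<phi> \<longrightarrow>
            (\<lambda>n. affine_change f x0 1 (delta_seq \<phi> n)) \<longlonglongrightarrow> \<gamma>)
         \<longleftrightarrow> has_symmetric_point_value f x0 \<gamma>"
proof
  assume hyp: "\<forall>\<phi>\<in>test_functions. positive_fun \<phi> \<and> normalized_fun \<phi> \<and> even_fun \<phi> \<longrightarrow>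
            (\<lambda>n. affine_change f x0 1 (delta_seq \<phi> n)) \<longlonglongrightarrow> \<gamma>"
  show "has_symmetric_point_value f x0 \<gamma>"
    unfolding has_symmetric_point_value_iff_zoom[OF assms]
  proof
    fix \<phi> assume \<phi>: "\<phi> \<in> test_functions"
    let ?\<psi> = "even_part \<phi>"
    note \<psi> = test_functions_even_part[OF \<phi>]
    have int\<psi>: "(LINT x|lborel. ?\<psi> x) = (LINT x|lborel. \<phi> x)"
      using lborel_integral_real_affine[of "-1" \<phi> 0] integrable_test_function[OF \<phi>]
        integrable_test_function[OF test_functions_reflect[OF \<phi>]]
      by (simp add: even_part_def)
    \<comment> \<open>Dilating the test function by \<open>c\<close> turns parameter
      \<open>n\<close> into \<open>n * c\<close>; the factor \<open>c\<close> is absorbed on one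
      side by \<open>zoom\<close> and on the other by the change of variables in the
      integral.\<close>
    have "(\<lambda>n. zoom f x0 ?\<psi> (real n * c)) \<longlonglongrightarrow> \<gamma> * (LINT x|lborel. ?\<psi> x)" if c: "c > 0" for c
    proof -
      have "even_fun (\<lambda>x. ?\<psi> (c * x))"
        by (simp add: even_fun_def even_part_def)
      moreover have "(\<lambda>x. ?\<psi> (c * x)) \<in> test_functions"
        using test_functions_affine[OF \<psi>, of c 0] c by simp
      ultimately have "(\<lambda>n. of_real c * zoom f x0 (\<lambda>x. ?\<psi> (c * x)) (real n)) \<longlonglongrightarrow>
          of_real c * (\<gamma> * (LINT x|lborel. ?\<psi> (c * x)))"
        by (intro tendsto_mult_left zoom_tendsto_even assms hyp)
      then show ?thesis
        using lborel_integral_real_affine[of c ?\<psi> 0] c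
        by (simp add: zoom_def scaleR_conv_of_real mult_ac)
    qed
    then have "(zoom f x0 ?\<psi> \<longlongrightarrow> \<gamma> * (LINT x|lborel. \<phi> x)) at_top"
      unfolding int\<psi> by (intro Croft continuous_on_zoom assms \<psi>)
    moreover have "filterlim (\<lambda>\<epsilon>::real. inverse \<bar>\<epsilon>\<bar>) at_top (at 0)"
      by (intro filterlim_inverse_at_top tendsto_rabs_zero tendsto_ident_at)
         (simp add: eventually_at_filter)
    ultimately show "((\<lambda>\<epsilon>. zoom f x0 ?\<psi> (inverse \<bar>\<epsilon>\<bar>)) \<longlongrightarrow> \<gamma> * (LINT x|lborel. \<phi> x)) (at 0)"
      by (rule filterlim_compose)
  qed
next
  assume sym: "has_symmetric_point_value f x0 \<gamma>"
  show "\<forall>\<phi>\<in>test_functions. positive_fun \<phi> \<and> normalized_fun \<phi> \<and> even_fun \<phi> \<longrightarrow>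
            (\<lambda>n. affine_change f x0 1 (delta_seq \<phi> n)) \<longlonglongrightarrow> \<gamma>"
  proof (intro ballI impI, elim conjE)
    fix \<phi> assume \<phi>: "\<phi> \<in> test_functions" "normalized_fun \<phi>" "even_fun \<phi>"
    have even: "even_part \<phi> = \<phi>"
      using \<phi>(3) by (auto simp: even_part_def even_fun_def)
    have "((\<lambda>\<epsilon>. zoom f x0 \<phi> (inverse \<bar>\<epsilon>\<bar>)) \<longlongrightarrow> \<gamma>) (at 0)"
      using sym \<phi> even by (auto simp: has_symmetric_point_value_iff_zoom[OF assms] normalized_fun_def)
    \<comment> \<open>The scales \<epsilon> = 1/n are inserted. The punctured filter requires them
      nonzero, which holds for n > 0, while \<open>inverse 0\<close> is 0.\<close>
    moreover have "filterlim (\<lambda>n. inverse (real n)) (at 0) sequentially"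
      unfolding filterlim_at using lim_inverse_n[where 'a = real] eventually_gt_at_top[of 0]
      by (auto elim: eventually_mono)
    ultimately have "(\<lambda>n. zoom f x0 \<phi> (inverse \<bar>inverse (real n)\<bar>)) \<longlonglongrightarrow> \<gamma>"
      by (rule filterlim_compose)
    then show "(\<lambda>n. affine_change f x0 1 (delta_seq \<phi> n)) \<longlonglongrightarrow> \<gamma>"
      by (rule Lim_transform_eventually)
        (use eventually_gt_at_top[of 0] in eventually_elim, simp add: zoom_delta_seq[OF assms \<phi>(1)])
  qed
qed

end
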